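(* Let $f_1$ and $f_1^*$ be the hidden variable recurrent fractal interpolation functions, constructed as in the context, for the data set $P=\{(x_i,y_i,z_i)\}_{i=0}^n$ and for the perturbed data set $P_{y^*}=\{(x_i,y_i^*,z_i)\}_{i=0}^n$ respectively. Suppose $$\omega+\tilde\omega<\frac{l_L}{L_L}.$$ Then $$\|f_1-f_1^*\|_\infty\le\frac{1+2\omega-\tilde\omega}{1-\omega-\tilde\omega}\,\max_i|y_i-y_i^*|.$$
   Context: Data and intervals. Let $P=\{(x_i,y_i,z_i)\in\mathbb{R}^3: i=0,\dots,n\}$ with $0=x_0<x_1<\dots<x_n=1$, $I=[0,1]$, $I_i=[x_{i-1},x_i]$ for $i=1,\dots,n$. Let $l$ be an integer with $2\le l\le n$, and for $k=1,\dots,l$ let $\tilde I_k=[x_{s(k)},x_{e(k)}]$ with $s(k),e(k)$ node indices, $e(k)-s(k)\ge2$. For each $i\in\{1,\dots,n\}$ an index $\gamma(i)\in\{1,\dots,l\}$ is chosen. $|J|$ denotes the length of an interval $J$. Maps. For each $i$, with $k=\gamma(i)$, $L_{i,k}:\tilde I_k\to I_i$ is a contraction homeomorphism with $L_{i,k}(\{x_{s(k)},x_{e(k)}\})=\{x_{i-1},x_i\}$. The functions $s_i,s'_i,\tilde s_i,\tilde s'_i:I_i\to\mathbb{R}$ are Lipschitz with absolute values less than $1$. The functions $q_{i,k},\tilde q_{i,k}:\tilde I_k\to\mathbb{R}$ are $$q_{i,k}(x)=-s_i(L_{i,k}(x))g_{i,k}(x)-s'_i(L_{i,k}(x))g'_{i,k}(x)+h_i(L_{i,k}(x)),$$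 $$\tilde q_{i,k}(x)=-\tilde s_i(L_{i,k}(x))g_{i,k}(x)-\tilde s'_i(L_{i,k}(x))g'_{i,k}(x)+\tilde h_i(L_{i,k}(x)),$$ where $$g_{i,k}(x)=\frac{x-x_{s(k)}}{x_{e(k)}-x_{s(k)}}y_{e(k)}+\frac{x-x_{e(k)}}{x_{s(k)}-x_{e(k)}}y_{s(k)},\quad g'_{i,k}(x)=\frac{x-x_{s(k)}}{x_{e(k)}-x_{s(k)}}z_{e(k)}+\frac{x-x_{e(k)}}{x_{s(k)}-x_{e(k)}}z_{s(k)},$$ $$h_i(x)=\frac{x-x_{i-1}}{x_i-x_{i-1}}y_i+\frac{x-x_i}{x_{i-1}-x_i}y_{i-1},\quad \tilde h_i(x)=\frac{x-x_{i-1}}{x_i-x_{i-1}}z_i+\frac{x-x_i}{x_{i-1}-x_i}z_{i-1}.$$ The function for $P$. $\vec f=(f_1,f_2):I\to\mathbb{R}^2$ is the unique continuous function with $\vec f(x_i)=(y_i,z_i)$ for all $i$ and, for $x\in I_i$ and $k=\gamma(i)$, $$f_1(x)=s_i(x)f_1(L_{i,k}^{-1}(x))+s'_i(x)f_2(L_{i,k}^{-1}(x))+q_{i,k}(L_{i,k}^{-1}(x)),$$ $$f_2(x)=\tilde s_i(x)f_1(L_{i,k}^{-1}(x))+\tilde s'_i(x)f_2(L_{i,k}^{-1}(x))+\tilde q_{i,k}(L_{i,k}^{-1}(x)).$$ Its first component $f_1$ is the hidden variable recurrent fractal interpolation function (HVRFIF). The function for $P_{y^*}$. Let $y_0^*,\dots,y_n^*\in\mathbb{R}$.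 The function $\vec f^*=(f_1^*,f_2^* )$ is obtained by the same construction with the same $x_i$, $z_i$, $\gamma$, $L_{i,k}$, $s_i,s'_i,\tilde s_i,\tilde s'_i$, and with $q_{i,k},\tilde q_{i,k}$ replaced by $q^*_{i,k},\tilde q^*_{i,k}$ given by the same formulas with every $y_j$ replaced by $y_j^*$; it satisfies $\vec f^*(x_i)=(y_i^*,z_i)$. Notation. For a function $g$, $\overline g=\max_x|g(x)|$. $\omega_j=\max\{\overline{s_j},\overline{s'_j}\}$, $\tilde\omega_j=\max\{\overline{\tilde s_j},\overline{\tilde s'_j}\}$, $\omega=\max_j\omega_j$, $\tilde\omega=\max_j\tilde\omega_j$, $$L_L=\max_{1\le k\le n}\frac{|I_k|}{|\tilde I_{\gamma(k)}|},\qquad l_L=\min_{1\le k\le n}\frac{|I_k|}{|\tilde I_{\gamma(k)}|}.$$ $\|\cdot\|_\infty$ is the supremum norm on $I$. *)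

theory Defs
  imports "HOL-Analysis.Analysis"
begin

text \<open>
  Conventions: nodes are \<open>x 0, \<dots>, x n\<close>, the subintervals are
  \<open>I\<^sub>i = {x (i - 1)..x i}\<close> for \<open>i \<in> {1..n}\<close>, and the domain intervals are
  \<open>{x (ns k)..x (ne k)}\<close> for \<open>k \<in> {1..l}\<close>, with \<open>ns\<close>, \<open>ne\<close> the start and end node indices.
  The scaling functions \<open>s\<^sub>i, s'\<^sub>i\<close> and their tilde counterparts are \<open>s i, s' i, st i, st' i\<close>.
  Values of the functions outside these index ranges and intervals are irrelevant.
\<close>

locale hv_rec_system =
  fixes n l :: nat
    and x :: "nat \<Rightarrow> real"
    and ns ne \<gamma> :: "nat \<Rightarrow> nat"
    and L :: "nat \<Rightarrow> nat \<Rightarrow> real \<Rightarrow> real"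
    and s s' st st' :: "nat \<Rightarrow> real \<Rightarrow> real"
  assumes nodes: "x 0 = 0" "x n = 1" "strict_mono_on {0..n} x"
    and num_domains: "2 \<le> l" "l \<le> n"
    and domains: "\<And>k. k \<in> {1..l} \<Longrightarrow> ns k + 2 \<le> ne k \<and> ne k \<le> n"
    and gamma: "\<And>i. i \<in> {1..n} \<Longrightarrow> \<gamma> i \<in> {1..l}"
    and L_homeo: "\<And>i k. i \<in> {1..n} \<Longrightarrow> k = \<gamma> i \<Longrightarrow>
      \<exists>L'. homeomorphism {x (ns k)..x (ne k)} {x (i - 1)..x i} (L i k) L'"
    and L_contraction: "\<And>i k. i \<in> {1..n} \<Longrightarrow> k = \<gamma> i \<Longrightarrow>
      \<exists>c<1. c-lipschitz_on {x (ns k)..x (ne k)} (L i k)"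
    and L_ends: "\<And>i k. i \<in> {1..n} \<Longrightarrow> k = \<gamma> i \<Longrightarrow>
      L i k ` {x (ns k), x (ne k)} = {x (i - 1), x i}"
    and scaling_lipschitz: "\<And>i g. i \<in> {1..n} \<Longrightarrow> g \<in> {s i, s' i, st i, st' i} \<Longrightarrow>
      \<exists>C. C-lipschitz_on {x (i - 1)..x i} g"
    and scaling_less_1: "\<And>i g t. i \<in> {1..n} \<Longrightarrow> g \<in> {s i, s' i, st i, st' i} \<Longrightarrow>
      t \<in> {x (i - 1)..x i} \<Longrightarrow> \<bar>g t\<bar> < 1"

text \<open>The affine function through \<open>(x i, w i)\<close> and \<open>(x j, w j)\<close>.\<close>

definition chord :: "(nat \<Rightarrow> real) \<Rightarrow> (nat \<Rightarrow> real) \<Rightarrow> nat \<Rightarrow> nat \<Rightarrow> real \<Rightarrow> real" where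
  "chord x w i j t =
     (t - x i) / (x j - x i) * w j + (t - x j) / (x i - x j) * w i"

text \<open>
  With \<open>(c, c', w) = (s, s', y)\<close> this is \<open>q\<^sub>i\<^sub>k\<close>; with \<open>(c, c', w) = (st, st', z)\<close> it is the
  tilde version of \<open>q\<^sub>i\<^sub>k\<close>. The three chords are \<open>g\<^sub>i\<^sub>k\<close>, \<open>g'\<^sub>i\<^sub>k\<close>, and \<open>h\<^sub>i\<close> or its tilde version.
\<close>

definition q_map ::
  "(nat \<Rightarrow> real) \<Rightarrow> (nat \<Rightarrow> nat) \<Rightarrow> (nat \<Rightarrow> nat) \<Rightarrow> (nat \<Rightarrow> nat \<Rightarrow> real \<Rightarrow> real) \<Rightarrow>
   (nat \<Rightarrow> real \<Rightarrow> real) \<Rightarrow> (nat \<Rightarrow> real \<Rightarrow> real) \<Rightarrow>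
   (nat \<Rightarrow> real) \<Rightarrow> (nat \<Rightarrow> real) \<Rightarrow> (nat \<Rightarrow> real) \<Rightarrow> nat \<Rightarrow> nat \<Rightarrow> real \<Rightarrow> real" where
  "q_map x ns ne L c c' y z w i k t =
     - c i (L i k t) * chord x y (ns k) (ne k) t
     - c' i (L i k t) * chord x z (ns k) (ne k) t
     + chord x w (i - 1) i (L i k t)"

text \<open>
  \<open>(f1, f2)\<close> is the continuous function interpolating \<open>(x i, y i, z i)\<close> and satisfying the
  functional equations of the system; \<open>f1\<close> is the hidden variable recurrent fractal
  interpolation function of these data.
\<close>

definition is_hvrfif ::
  "nat \<Rightarrow> (nat \<Rightarrow> real) \<Rightarrow> (nat \<Rightarrow> nat) \<Rightarrow> (nat \<Rightarrow> nat) \<Rightarrow> (nat \<Rightarrow> nat) \<Rightarrow>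
   (nat \<Rightarrow> nat \<Rightarrow> real \<Rightarrow> real) \<Rightarrow>
   (nat \<Rightarrow> real \<Rightarrow> real) \<Rightarrow> (nat \<Rightarrow> real \<Rightarrow> real) \<Rightarrow>
   (nat \<Rightarrow> real \<Rightarrow> real) \<Rightarrow> (nat \<Rightarrow> real \<Rightarrow> real) \<Rightarrow>
   (nat \<Rightarrow> real) \<Rightarrow> (nat \<Rightarrow> real) \<Rightarrow> (real \<Rightarrow> real) \<Rightarrow> (real \<Rightarrow> real) \<Rightarrow> bool" where
  "is_hvrfif n x ns ne \<gamma> L s s' st st' y z f1 f2 \<longleftrightarrow>
     continuous_on {0..1} (\<lambda>t. (f1 t, f2 t)) \<and>
     (\<forall>i\<in>{0..n}. (f1 (x i), f2 (x i)) = (y i, z i)) \<and>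
     (\<forall>i\<in>{1..n}. \<forall>t\<in>{x (i - 1)..x i}.
        let k = \<gamma> i; r = inv_into {x (ns k)..x (ne k)} (L i k) t in
          f1 t = s i t * f1 r + s' i t * f2 r + q_map x ns ne L s s' y z y i k r \<and>
          f2 t = st i t * f1 r + st' i t * f2 r + q_map x ns ne L st st' y z z i k r)"

definition sup_norm :: "real set \<Rightarrow> (real \<Rightarrow> real) \<Rightarrow> real" where
  "sup_norm S g = (SUP t\<in>S. \<bar>g t\<bar>)"

text \<open>\<open>omega n x s s'\<close> is \<open>\<omega>\<close>; \<open>omega n x st st'\<close> is its tilde version.\<close>

definition omega ::
  "nat \<Rightarrow> (nat \<Rightarrow> real) \<Rightarrow> (nat \<Rightarrow> real \<Rightarrow> real) \<Rightarrow> (nat \<Rightarrow> real \<Rightarrow> real) \<Rightarrow> real" where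
  "omega n x c c' =
     (MAX j\<in>{1..n}. max (sup_norm {x (j - 1)..x j} (c j)) (sup_norm {x (j - 1)..x j} (c' j)))"

definition length_ratio ::
  "(nat \<Rightarrow> real) \<Rightarrow> (nat \<Rightarrow> nat) \<Rightarrow> (nat \<Rightarrow> nat) \<Rightarrow> (nat \<Rightarrow> nat) \<Rightarrow> nat \<Rightarrow> real" where
  "length_ratio x ns ne \<gamma> i = (x i - x (i - 1)) / (x (ne (\<gamma> i)) - x (ns (\<gamma> i)))"

definition max_ratio ::
  "nat \<Rightarrow> (nat \<Rightarrow> real) \<Rightarrow> (nat \<Rightarrow> nat) \<Rightarrow> (nat \<Rightarrow> nat) \<Rightarrow> (nat \<Rightarrow> nat) \<Rightarrow> real" where
  "max_ratio n x ns ne \<gamma> = (MAX i\<in>{1..n}. length_ratio x ns ne \<gamma> i)"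

definition min_ratio ::
  "nat \<Rightarrow> (nat \<Rightarrow> real) \<Rightarrow> (nat \<Rightarrow> nat) \<Rightarrow> (nat \<Rightarrow> nat) \<Rightarrow> (nat \<Rightarrow> nat) \<Rightarrow> real" where
  "min_ratio n x ns ne \<gamma> = (MIN i\<in>{1..n}. length_ratio x ns ne \<gamma> i)"

end

theory Submission imports Defs begin

text \<open>
  Let \<open>D1 = f1 - f1s\<close>, \<open>D2 = f2 - f2s\<close>, with sup norms \<open>A\<close>, \<open>B\<close>, and let \<open>M\<close> be the largest
  perturbation of the \<open>y i\<close>. Subtracting the functional equations leaves only the chords of the
  differences \<open>y i - ys i\<close>, which are bounded by \<open>M\<close>; hence
  \<open>A \<le> \<omega> (A + M) + \<omega> B + M\<close> and \<open>B \<le> \<omega>t (A + M) + \<omega>t B\<close>. Eliminating \<open>B\<close> gives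
  \<open>(1 - \<omega> - \<omega>t) A \<le> (1 + \<omega> - \<omega>t) M\<close>, which is slightly sharper than the claim. Since
  \<open>l\<^sub>L \<le> L\<^sub>L\<close>, the ratio condition gives the positivity of \<open>1 - \<omega> - \<omega>t\<close>.
\<close>

text \<open>The two weights of a chord are \<open>a\<close> and \<open>1 - a\<close> with
  \<open>a\<close> in the unit interval, so its value is a convex combination of the end
  ordinates.\<close>

lemma abs_chord_le:
  assumes "x i < x j" "t \<in> {x i..x j}" "\<bar>w i\<bar> \<le> M" "\<bar>w j\<bar> \<le> M"
  shows "\<bar>chord x w i j t\<bar> \<le> M"
proof -
  define a where "a = (t - x i) / (x j - x i)"
  have a: "0 \<le> a" "a \<le> 1"
    using assms(1,2) by (auto simp: a_def)
  have "(t - x j) / (x i - x j) = 1 - a"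
    using assms(1) by (simp add: a_def divide_simps) (simp add: algebra_simps)
  then have "chord x w i j t = a * w j + (1 - a) * w i"
    by (simp add: chord_def a_def)
  then have "\<bar>chord x w i j t\<bar> \<le> a * \<bar>w j\<bar> + (1 - a) * \<bar>w i\<bar>"
    using a by (simp add: order_trans[OF abs_triangle_ineq] abs_mult)
  also have "\<dots> \<le> M"
    using a assms(3,4) by (intro convex_bound_le) auto
  finally show ?thesis .
qed

text \<open>Linearity in the ordinates: subtracting the two systems leaves chords of the
  perturbation alone.\<close>

lemma chord_diff:
  "chord x v i j t - chord x w i j t = chord x (\<lambda>m. v m - w m) i j t"
  by (simp add: chord_def right_diff_distrib)

lemma subinterval_exists:
  fixes x :: "nat \<Rightarrow> real"
  assumes "t \<in> {x 0..x n}" "1 \<le> n"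
  shows "\<exists>i\<in>{1..n}. t \<in> {x (i - 1)..x i}"
  using assms(2,1)
proof (induction n rule: dec_induct)
  case base
  then show ?case by auto
next
  case (step n)
  show ?case
  proof (cases "t \<le> x n")
    case True
    with step show ?thesis by fastforce
  next
    case False
    with step.prems show ?thesis by (intro bexI[of _ "Suc n"]) auto
  qed
qed

text \<open>The bound \<open>B\<close> serves only to make the values bounded above, so that the
  real supremum is an upper bound.\<close>

lemma abs_le_sup_norm:
  assumes "\<And>u. u \<in> S \<Longrightarrow> \<bar>g u\<bar> \<le> B" "t \<in> S"
  shows "\<bar>g t\<bar> \<le> sup_norm S g"
  unfolding sup_norm_def using assms by (intro cSUP_upper bdd_aboveI2)

lemma abs_le_omega:
  assumes "i \<in> {1..n}" "t \<in> {x (i - 1)..x i}"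
    and "\<And>u. u \<in> {x (i - 1)..x i} \<Longrightarrow> \<bar>c i u\<bar> < 1"
    and "\<And>u. u \<in> {x (i - 1)..x i} \<Longrightarrow> \<bar>c' i u\<bar> < 1"
  shows "\<bar>c i t\<bar> \<le> omega n x c c'" "\<bar>c' i t\<bar> \<le> omega n x c c'"
proof -
  have *: "max (sup_norm {x (i - 1)..x i} (c i)) (sup_norm {x (i - 1)..x i} (c' i))
      \<le> omega n x c c'"
    unfolding omega_def using assms(1) by (intro Max_ge) auto
  have "\<bar>c i t\<bar> \<le> sup_norm {x (i - 1)..x i} (c i)"
    by (rule abs_le_sup_norm[OF less_imp_le[OF assms(3)] assms(2)])
  with * show "\<bar>c i t\<bar> \<le> omega n x c c'" by simp
  have "\<bar>c' i t\<bar> \<le> sup_norm {x (i - 1)..x i} (c' i)"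
    by (rule abs_le_sup_norm[OF less_imp_le[OF assms(4)] assms(2)])
  with * show "\<bar>c' i t\<bar> \<le> omega n x c c'" by simp
qed

text \<open>The scaling function that multiplies \<open>f1\<close> also multiplies the chord of the
  \<open>y\<close> values, with opposite sign. Grouping them as \<open>u - g\<close> charges
  \<open>w\<close> once, against \<open>A + M\<close>.\<close>

lemma abs_scaled_combination_le:
  fixes a b u v g :: real
  assumes "\<bar>a\<bar> \<le> w" "\<bar>b\<bar> \<le> w" "\<bar>u\<bar> \<le> A" "\<bar>g\<bar> \<le> M" "\<bar>v\<bar> \<le> B"
  shows "\<bar>a * (u - g) + b * v\<bar> \<le> w * (A + M) + w * B"
proof -
  have "\<bar>a * (u - g)\<bar> \<le> w * (A + M)"
    unfolding abs_mult using assms by (intro mult_mono) auto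
  moreover have "\<bar>b * v\<bar> \<le> w * B"
    unfolding abs_mult using assms by (intro mult_mono) auto
  ultimately show ?thesis by linarith
qed

lemma coupled_bounds_imp:
  fixes A B M w v :: real
  assumes A: "A \<le> w * (A + M) + w * B + M" and B: "B \<le> v * (A + M) + v * B"
    and "0 \<le> w" "0 \<le> v" "w + v < 1" "0 \<le> M"
  shows "A \<le> (1 + 2 * w - v) / (1 - w - v) * M"
proof -
  \<comment> \<open>The second bound reads \<open>(1 - v) * B \<le> v * (A + M)\<close>. Scaling the
    first by \<open>1 - v\<close> and the second by \<open>w\<close> eliminates \<open>B\<close>,
    and the \<open>w * v\<close> terms cancel.\<close>
  have "(1 - v) * A \<le> (1 - v) * (w * (A + M) + w * B + M)"
    using A assms by (intro mult_left_mono) auto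
  moreover have "w * B \<le> w * (v * (A + M) + v * B)"
    using B assms by (intro mult_left_mono) auto
  \<comment> \<open>This slack relaxes the factor \<open>1 + w - v\<close> to
    \<open>1 + 2 * w - v\<close>.\<close>
  moreover have "0 \<le> w * M"
    using assms by simp
  ultimately have "(1 - w - v) * A \<le> (1 + 2 * w - v) * M"
    by (simp add: algebra_simps)
  then show ?thesis
    using assms by (simp add: pos_le_divide_eq mult.commute)
qed

context hv_rec_system
begin

lemma n_pos: "1 \<le> n"
  using num_domains by simp

lemma node_less: "i < j \<Longrightarrow> j \<le> n \<Longrightarrow> x i < x j"
  using nodes(3) by (auto simp: strict_mono_on_def)

lemma node_in_unit:
  assumes "i \<le> n"
  shows "x i \<in> {0..1}"
  using assms node_less[of 0 i] node_less[of i n] nodes(1,2)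
  by (cases "i = 0"; cases "i = n") auto

lemma domain_less:
  assumes "i \<in> {1..n}"
  shows "x (ns (\<gamma> i)) < x (ne (\<gamma> i))"
  using domains[OF gamma[OF assms]] by (intro node_less) auto

lemma domain_subset:
  assumes "i \<in> {1..n}"
  shows "{x (ns (\<gamma> i))..x (ne (\<gamma> i))} \<subseteq> {0..1}"
  using domains[OF gamma[OF assms]] node_in_unit[of "ns (\<gamma> i)"] node_in_unit[of "ne (\<gamma> i)"]
  by auto

text \<open>The ratio of the first subinterval lies between the two extremes, and its positivity
  makes the denominator positive.\<close>

lemma min_ratio_div_max_ratio_le_1: "min_ratio n x ns ne \<gamma> / max_ratio n x ns ne \<gamma> \<le> 1"
proof -
  let ?r = "length_ratio x ns ne \<gamma>"
  have "?r 1 > 0"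
    using domain_less[of 1] node_less[of 0 1] n_pos by (auto simp: length_ratio_def)
  moreover have "min_ratio n x ns ne \<gamma> \<le> ?r 1"
    unfolding min_ratio_def using n_pos by (intro Min_le) auto
  moreover have "?r 1 \<le> max_ratio n x ns ne \<gamma>"
    unfolding max_ratio_def using n_pos by (intro Max_ge) auto
  ultimately show ?thesis by simp
qed

text \<open>A homeomorphism is onto, so \<open>inv_into\<close> gives a genuine preimage; the
  scaling functions inside \<open>q_map\<close> are then evaluated at \<open>t\<close>
  itself.\<close>

lemma preimage:
  assumes "i \<in> {1..n}" "t \<in> {x (i - 1)..x i}"
    and "r = inv_into {x (ns (\<gamma> i))..x (ne (\<gamma> i))} (L i (\<gamma> i)) t"
  shows "r \<in> {x (ns (\<gamma> i))..x (ne (\<gamma> i))}" "L i (\<gamma> i) r = t"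
proof -
  have "t \<in> L i (\<gamma> i) ` {x (ns (\<gamma> i))..x (ne (\<gamma> i))}"
    using L_homeo[OF assms(1) refl] assms(2) unfolding homeomorphism_def by blast
  then show "r \<in> {x (ns (\<gamma> i))..x (ne (\<gamma> i))}" "L i (\<gamma> i) r = t"
    unfolding assms(3) by (rule inv_into_into, rule f_inv_into_f)
qed

lemma scaling_le_omega:
  assumes "i \<in> {1..n}" "t \<in> {x (i - 1)..x i}"
  shows "\<bar>s i t\<bar> \<le> omega n x s s'" "\<bar>s' i t\<bar> \<le> omega n x s s'"
    "\<bar>st i t\<bar> \<le> omega n x st st'" "\<bar>st' i t\<bar> \<le> omega n x st st'"
proof -
  have "\<bar>g u\<bar> < 1" if "g \<in> {s i, s' i, st i, st' i}" "u \<in> {x (i - 1)..x i}" for g u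
    using scaling_less_1[OF assms(1) that] .
  then show "\<bar>s i t\<bar> \<le> omega n x s s'" "\<bar>s' i t\<bar> \<le> omega n x s s'"
    "\<bar>st i t\<bar> \<le> omega n x st st'" "\<bar>st' i t\<bar> \<le> omega n x st st'"
    using abs_le_omega[where x = x, OF assms] by simp_all
qed

lemma omega_nonneg: "0 \<le> omega n x s s'" "0 \<le> omega n x st st'"
proof -
  have "1 \<in> {1..n}" "x 1 \<in> {x (1 - 1)..x 1}"
    using n_pos node_less[of 0 1] by auto
  from scaling_le_omega[OF this] show "0 \<le> omega n x s s'" "0 \<le> omega n x st st'"
    by linarith+
qed

text \<open>Both systems use the same preimage and coefficients, so their equations subtract
  termwise. Any uniform bounds \<open>A\<close>, \<open>B\<close> are allowed, since the preimage of
  \<open>t\<close> may lie elsewhere in the unit interval.\<close>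

lemma hvrfif_diff_step:
  assumes f: "is_hvrfif n x ns ne \<gamma> L s s' st st' y z f1 f2"
    and fs: "is_hvrfif n x ns ne \<gamma> L s s' st st' ys z f1s f2s"
    and t: "t \<in> {0..1}"
    and M: "\<And>i. i \<le> n \<Longrightarrow> \<bar>y i - ys i\<bar> \<le> M"
    and A: "\<And>u. u \<in> {0..1} \<Longrightarrow> \<bar>f1 u - f1s u\<bar> \<le> A"
    and B: "\<And>u. u \<in> {0..1} \<Longrightarrow> \<bar>f2 u - f2s u\<bar> \<le> B"
  shows "\<bar>f1 t - f1s t\<bar> \<le> omega n x s s' * (A + M) + omega n x s s' * B + M"
    and "\<bar>f2 t - f2s t\<bar> \<le> omega n x st st' * (A + M) + omega n x st st' * B"
proof -
  \<comment> \<open>At an interior node two indices qualify; either will do, as the equations hold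
    on closed subintervals.\<close>
  obtain i where i: "i \<in> {1..n}" "t \<in> {x (i - 1)..x i}"
    using subinterval_exists[of t x n] t nodes(1,2) n_pos by auto
  define k where "k = \<gamma> i"
  define r where "r = inv_into {x (ns k)..x (ne k)} (L i k) t"
  have r: "r \<in> {x (ns k)..x (ne k)}" and Lr: "L i k r = t"
    using preimage[OF i] by (auto simp: k_def r_def)
  have r01: "r \<in> {0..1}"
    using r domain_subset[OF i(1)] by (auto simp: k_def)
  define g where "g = chord x (\<lambda>m. y m - ys m) (ns k) (ne k) r"
  define h where "h = chord x (\<lambda>m. y m - ys m) (i - 1) i t"
  have g: "\<bar>g\<bar> \<le> M"
    unfolding g_def using domain_less[OF i(1)] r domains[OF gamma[OF i(1)]]
    by (intro abs_chord_le M) (auto simp: k_def)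
  have h: "\<bar>h\<bar> \<le> M"
    unfolding h_def using i by (intro abs_chord_le M node_less) auto
  have g_eq: "chord x y (ns k) (ne k) r = g + chord x ys (ns k) (ne k) r"
    using chord_diff[of x y "ns k" "ne k" r ys] by (simp add: g_def)
  have h_eq: "chord x y (i - 1) i t = h + chord x ys (i - 1) i t"
    using chord_diff[of x y "i - 1" i t ys] by (simp add: h_def)
  have eqs:
    "f1 t = s i t * f1 r + s' i t * f2 r + q_map x ns ne L s s' y z y i k r"
    "f2 t = st i t * f1 r + st' i t * f2 r + q_map x ns ne L st st' y z z i k r"
    "f1s t = s i t * f1s r + s' i t * f2s r + q_map x ns ne L s s' ys z ys i k r"
    "f2s t = st i t * f1s r + st' i t * f2s r + q_map x ns ne L st st' ys z z i k r"
    using f fs i unfolding is_hvrfif_def Let_def r_def k_def by blast+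
  have "f1 t - f1s t = s i t * ((f1 r - f1s r) - g) + s' i t * (f2 r - f2s r) + h"
    unfolding eqs q_map_def Lr g_eq h_eq by (simp add: algebra_simps)
  moreover have "\<bar>s i t * ((f1 r - f1s r) - g) + s' i t * (f2 r - f2s r)\<bar>
      \<le> omega n x s s' * (A + M) + omega n x s s' * B"
    by (intro abs_scaled_combination_le scaling_le_omega i A B r01 g)
  ultimately show "\<bar>f1 t - f1s t\<bar> \<le> omega n x s s' * (A + M) + omega n x s s' * B + M"
    using h by linarith
  \<comment> \<open>No \<open>h\<close> appears: the last chord here interpolates the unperturbed
    \<open>z\<close>, so it cancels.\<close>
  have "f2 t - f2s t = st i t * ((f1 r - f1s r) - g) + st' i t * (f2 r - f2s r)"
    unfolding eqs q_map_def Lr g_eq by (simp add: algebra_simps)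
  also have "\<bar>\<dots>\<bar> \<le> omega n x st st' * (A + M) + omega n x st st' * B"
    by (intro abs_scaled_combination_le scaling_le_omega i A B r01 g)
  finally show "\<bar>f2 t - f2s t\<bar> \<le> omega n x st st' * (A + M) + omega n x st st' * B" .
qed

end

lemma is_hvrfif_continuous:
  assumes "is_hvrfif n x ns ne \<gamma> L s s' st st' y z f1 f2"
  shows "continuous_on {0..1} f1" "continuous_on {0..1} f2"
  using assms continuous_on_fst[of "{0..1}" "\<lambda>t. (f1 t, f2 t)"]
    continuous_on_snd[of "{0..1}" "\<lambda>t. (f1 t, f2 t)"]
  by (simp_all add: is_hvrfif_def)

text \<open>Maximisers let the one-step estimate be applied at the very points where the sup norms
  are attained, giving inequalities with those norms on both sides.\<close>

lemma abs_attains_sup_unit: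
  fixes f :: "real \<Rightarrow> real"
  assumes "continuous_on {0..1} f"
  obtains t where "t \<in> {0..1}" "\<And>u. u \<in> {0..1} \<Longrightarrow> \<bar>f u\<bar> \<le> \<bar>f t\<bar>"
  using continuous_attains_sup[of "{0..1}" "\<lambda>t. \<bar>f t\<bar>"] continuous_on_rabs[OF assms] by auto

theorem theorem5:
  fixes n l :: nat
    and x y ys z :: "nat \<Rightarrow> real"
    and ns ne \<gamma> :: "nat \<Rightarrow> nat"
    and L :: "nat \<Rightarrow> nat \<Rightarrow> real \<Rightarrow> real"
    and s s' st st' :: "nat \<Rightarrow> real \<Rightarrow> real"
    and f1 f2 f1s f2s :: "real \<Rightarrow> real"
    and \<omega> \<omega>t :: real
  assumes system: "hv_rec_system n l x ns ne \<gamma> L s s' st st'"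
    and f: "is_hvrfif n x ns ne \<gamma> L s s' st st' y z f1 f2"
    and fs: "is_hvrfif n x ns ne \<gamma> L s s' st st' ys z f1s f2s"
    and omega: "\<omega> = omega n x s s'"
    and omega_tilde: "\<omega>t = omega n x st st'"
    and small: "\<omega> + \<omega>t < min_ratio n x ns ne \<gamma> / max_ratio n x ns ne \<gamma>"
  shows "sup_norm {0..1} (\<lambda>t. f1 t - f1s t) \<le>
    (1 + 2 * \<omega> - \<omega>t) / (1 - \<omega> - \<omega>t) * (MAX i\<in>{0..n}. \<bar>y i - ys i\<bar>)"
proof -
  interpret hv_rec_system n l x ns ne \<gamma> L s s' st st' by (rule system)
  define M where "M = (MAX i\<in>{0..n}. \<bar>y i - ys i\<bar>)"
  have M: "\<bar>y i - ys i\<bar> \<le> M" if "i \<le> n" for i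
    unfolding M_def using that by (intro Max_ge) auto
  obtain t1 where t1: "t1 \<in> {0..1}"
    and A: "\<And>u. u \<in> {0..1} \<Longrightarrow> \<bar>f1 u - f1s u\<bar> \<le> \<bar>f1 t1 - f1s t1\<bar>"
    using abs_attains_sup_unit[of "\<lambda>t. f1 t - f1s t"]
      is_hvrfif_continuous(1)[OF f] is_hvrfif_continuous(1)[OF fs] continuous_on_diff by blast
  obtain t2 where t2: "t2 \<in> {0..1}"
    and B: "\<And>u. u \<in> {0..1} \<Longrightarrow> \<bar>f2 u - f2s u\<bar> \<le> \<bar>f2 t2 - f2s t2\<bar>"
    using abs_attains_sup_unit[of "\<lambda>t. f2 t - f2s t"]
      is_hvrfif_continuous(2)[OF f] is_hvrfif_continuous(2)[OF fs] continuous_on_diff by blast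
  have "\<bar>f1 t1 - f1s t1\<bar> \<le> (1 + 2 * \<omega> - \<omega>t) / (1 - \<omega> - \<omega>t) * M"
  proof (rule coupled_bounds_imp)
    show "\<bar>f1 t1 - f1s t1\<bar>
        \<le> \<omega> * (\<bar>f1 t1 - f1s t1\<bar> + M) + \<omega> * \<bar>f2 t2 - f2s t2\<bar> + M"
      unfolding omega by (rule hvrfif_diff_step(1)[OF f fs t1 M A B])
    show "\<bar>f2 t2 - f2s t2\<bar>
        \<le> \<omega>t * (\<bar>f1 t1 - f1s t1\<bar> + M) + \<omega>t * \<bar>f2 t2 - f2s t2\<bar>"
      unfolding omega_tilde by (rule hvrfif_diff_step(2)[OF f fs t2 M A B])
    show "\<omega> + \<omega>t < 1"
      using small min_ratio_div_max_ratio_le_1 by linarith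
    show "0 \<le> M"
      using M[of 0] by linarith
  qed (simp_all add: omega omega_tilde omega_nonneg)
  with A have "\<bar>f1 u - f1s u\<bar> \<le> (1 + 2 * \<omega> - \<omega>t) / (1 - \<omega> - \<omega>t) * M"
    if "u \<in> {0..1}" for u
    using that by (meson order_trans)
  then show ?thesis
    unfolding sup_norm_def M_def by (intro cSUP_least) auto
qed

end
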